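(* Let $a\ge 2$ be an integer and let $x\ge 1$ be an integer. (1) For every integer $i\ge 1$, let $\mathbb{P}_a^{x,i}$ denote the set of $a$-core partitions $\lambda$ whose largest part is $x$ and which have exactly $i$ parts equal to $x$. Then $$|\mathbb{P}_a^{x,i}|=\binom{x+a-2-i}{a-1-i}.$$ (2) The number of $a$-core partitions with largest part $x$ is $\binom{x+a-2}{x}$. (3) For every integer $y$ with $1\le y\le x$, the number of $a$-core partitions with largest part $x$ and second largest part $y$ (that is, $\lambda_1=x$ and $\lambda_2=y$) is \[ \begin{cases} \binom{y+a-3}{y} & \text{if } x-y<a-1,\\ \binom{y+a-2}{y} & \text{if } x-y=a-1. \end{cases} \]
   Context: A partition is a finite non-increasing sequence $\lambda=(\lambda_1,\lambda_2,\dots,\lambda_\ell)$ of positive integers, called its parts. The second largest part is counted with multiplicity, i.e. it is $\lambda_2$, which may equal $\lambda_1$. The hook length of a cell of the Ferrers diagram of $\lambda$ is the number of cells in its arm plus the number in its leg plus one. A partition is an $a$-core if no cell of its Ferrers diagram has hook length divisible by $a$. Convention: $\binom{p}{q}=0$ if either $p$ or $q$ is negative. *)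

theory Defs
  imports Main
begin

text \<open>Partitions are lists of parts; list positions are 0-based, so \<open>\<lambda>\<^sub>1\<close> is \<open>p ! 0\<close>
  and \<open>\<lambda>\<^sub>2\<close> is \<open>p ! 1\<close>.\<close>

definition is_partition :: "nat list \<Rightarrow> bool" where
  "is_partition p \<longleftrightarrow> sorted_wrt (\<ge>) p \<and> (\<forall>k\<in>set p. k > 0)"

definition ferrers :: "nat list \<Rightarrow> (nat \<times> nat) set" where
  "ferrers p = {(r, c). r < length p \<and> c < p ! r}"

definition arm :: "nat list \<Rightarrow> nat \<times> nat \<Rightarrow> (nat \<times> nat) set" where
  "arm p u = {v \<in> ferrers p. fst v = fst u \<and> snd v > snd u}"

definition leg :: "nat list \<Rightarrow> nat \<times> nat \<Rightarrow> (nat \<times> nat) set" where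
  "leg p u = {v \<in> ferrers p. fst v > fst u \<and> snd v = snd u}"

definition hook_length :: "nat list \<Rightarrow> nat \<times> nat \<Rightarrow> nat" where
  "hook_length p u = card (arm p u) + card (leg p u) + 1"

definition is_core :: "nat \<Rightarrow> nat list \<Rightarrow> bool" where
  "is_core a p \<longleftrightarrow> is_partition p \<and> (\<forall>u\<in>ferrers p. \<not> a dvd hook_length p u)"

definition cores_largest :: "nat \<Rightarrow> nat \<Rightarrow> nat list set" where
  "cores_largest a x = {p. is_core a p \<and> length p \<ge> 1 \<and> p ! 0 = x}"

definition cores_largest_mult :: "nat \<Rightarrow> nat \<Rightarrow> nat \<Rightarrow> nat list set" where
  "cores_largest_mult a x i = {p \<in> cores_largest a x. count_list p x = i}"

definition cores_two_largest :: "nat \<Rightarrow> nat \<Rightarrow> nat \<Rightarrow> nat list set" where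
  "cores_two_largest a x y = {p \<in> cores_largest a x. length p \<ge> 2 \<and> p ! 1 = y}"

text \<open>Integer arguments, so that subtraction does not truncate and the convention that
  the coefficient vanishes for a negative argument can be expressed.\<close>

definition binom :: "int \<Rightarrow> int \<Rightarrow> nat" where
  "binom p q = (if p < 0 \<or> q < 0 then 0 else nat p choose nat q)"

end

theory Submission
  imports Defs
begin

text \<open>Send a partition to the set of hook lengths of its first row. This is a bijection onto the
  finite sets of positive integers, and the partition is an \<open>a\<close>-core iff no element of the set
  exceeds a non-element by a multiple of \<open>a\<close>. Such a set consists of an initial segment of each
  nonzero residue class modulo \<open>a\<close>, so it is given by \<open>a - 1\<close> natural numbers, whose sum is the
  largest part. The multiplicity of the largest part is the least element of the set, and
  \<open>\<lambda>\<^sub>1 - \<lambda>\<^sub>2 + 1\<close> is the least positive non-element; both are read off the \<open>a - 1\<close> numbers, and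
  each claim becomes a count of weak compositions.\<close>

section \<open>The set of first-row hook lengths\<close>

text \<open>The value 0 on the empty list lets a last row be treated like any other: the row below
  it has length 0.\<close>

definition largest :: "nat list \<Rightarrow> nat" where
  "largest p = (if p = [] then 0 else hd p)"

text \<open>Cells past the end of the second row have no leg and give the hooks 1 to
  \<open>x - largest p\<close>. Any other cell has the hook of the cell below it, plus
  \<open>x - largest p\<close> for the longer arm and 1 for the longer leg. On partitions this is
  the beta-set of the conjugate.\<close>

fun row_hooks :: "nat list \<Rightarrow> nat set" where
  "row_hooks [] = {}"
| "row_hooks (x # p) = {1..x - largest p} \<union> (+) (Suc (x - largest p)) ` row_hooks p"

text \<open>This is the flush condition on an abacus: descending by multiples of \<open>a\<close>
  never leaves the set. The choice \<open>b = 0\<close> excludes multiples of \<open>a\<close> from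
  \<open>G\<close>.\<close>

definition core_set :: "nat \<Rightarrow> nat set \<Rightarrow> bool" where
  "core_set a G \<longleftrightarrow> finite G \<and> 0 \<notin> G \<and> (\<forall>g\<in>G. \<forall>b. b \<notin> G \<and> b < g \<longrightarrow> \<not> a dvd g - b)"

lemma largest_simps [simp]: "largest [] = 0" "largest (x # p) = x"
  by (simp_all add: largest_def)

lemma is_partition_Nil [simp]: "is_partition []"
  by (simp add: is_partition_def)

lemma is_partition_Cons:
  "is_partition (x # p) \<longleftrightarrow> x > 0 \<and> largest p \<le> x \<and> is_partition p"
  by (cases p) (auto simp: is_partition_def)

lemma largest_pos: "is_partition p \<Longrightarrow> p \<noteq> [] \<Longrightarrow> largest p > 0"
  by (cases p) (auto simp: is_partition_Cons)

lemma nth_le_largest: "is_partition p \<Longrightarrow> r < length p \<Longrightarrow> p ! r \<le> largest p"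
proof (induction p arbitrary: r)
  case (Cons x p)
  then show ?case
    by (cases r) (force simp: is_partition_Cons)+
qed simp

lemma finite_row_hooks [simp]: "finite (row_hooks p)"
  by (induction p) auto

lemma zero_notin_row_hooks [simp]: "0 \<notin> row_hooks p"
  by (induction p) auto

text \<open>The initial interval ends one short of the shift, so from the shift onwards only the
  translated copy contributes.\<close>

lemma shift_mem_row_hooks_Cons:
  "Suc (x - largest p) + g \<in> row_hooks (x # p) \<longleftrightarrow> g \<in> row_hooks p"
  by auto

lemma card_row_hooks: "is_partition p \<Longrightarrow> card (row_hooks p) = largest p"
proof (induction p)
  case (Cons x p)
  have "card (row_hooks (x # p)) = card {1..x - largest p} +
      card ((+) (Suc (x - largest p)) ` row_hooks p)"
    unfolding row_hooks.simps by (rule card_Un_disjoint) auto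
  also have "card ((+) (Suc (x - largest p)) ` row_hooks p) = card (row_hooks p)"
    by (rule card_image) simp
  finally show ?case
    using Cons by (simp add: is_partition_Cons)
qed simp

text \<open>The leg is expressed through row indices because putting a new row on top acts on them
  by \<open>Suc\<close>.\<close>

lemma hook_length_eq:
  assumes "r < length p"
  shows "hook_length p (r, c) =
    p ! r - Suc c + card {s. r < s \<and> s < length p \<and> c < p ! s} + 1"
proof -
  have "arm p (r, c) = Pair r ` {c<..<p ! r}"
    using assms by (auto simp: arm_def ferrers_def)
  then have "card (arm p (r, c)) = p ! r - Suc c"
    by (simp add: card_image inj_on_def)
  moreover have "leg p (r, c) = (\<lambda>s. (s, c)) ` {s. r < s \<and> s < length p \<and> c < p ! s}"
    by (auto simp: leg_def ferrers_def)
  then have "card (leg p (r, c)) = card {s. r < s \<and> s < length p \<and> c < p ! s}"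
    by (simp add: card_image inj_on_def)
  ultimately show ?thesis
    by (simp add: hook_length_def)
qed

lemma hook_length_Cons_Suc:
  assumes "r < length p"
  shows "hook_length (x # p) (Suc r, c) = hook_length p (r, c)"
proof -
  have "{s. Suc r < s \<and> s < length (x # p) \<and> c < (x # p) ! s} =
      Suc ` {s. r < s \<and> s < length p \<and> c < p ! s}"
    by (auto simp: image_iff gr0_conv_Suc less_Suc_eq_0_disj dest: Suc_lessE)
  then show ?thesis
    using assms by (simp add: hook_length_eq card_image)
qed

lemma hook_length_Cons_0:
  assumes "c < largest p" "largest p \<le> x"
  shows "hook_length (x # p) (0, c) = Suc (x - largest p) + hook_length p (0, c)"
proof -
  have p: "p \<noteq> []" and hd: "p ! 0 = largest p"
    using assms(1) by (auto simp: largest_def hd_conv_nth split: if_splits)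
  \<comment> \<open>The inserted 0 is the first row of \<open>p\<close>: the cell directly below
    \<open>(0, c)\<close> joins the leg.\<close>
  have "{s. 0 < s \<and> s < length (x # p) \<and> c < (x # p) ! s} =
      Suc ` insert 0 {s. 0 < s \<and> s < length p \<and> c < p ! s}" (is "?L = Suc ` insert 0 ?R")
    using assms p hd by (auto simp: image_iff gr0_conv_Suc less_Suc_eq_0_disj)
  then have "card ?L = Suc (card ?R)"
    by (simp only: card_image[OF inj_Suc[THEN inj_on_subset[OF _ subset_UNIV]]]) simp
  then show ?thesis
    using assms p hd by (simp add: hook_length_eq)
qed

lemma hook_length_Cons_0_beyond:
  assumes "is_partition p" "largest p \<le> c" "c < x"
  shows "hook_length (x # p) (0, c) = x - c"
proof -
  have "{s. 0 < s \<and> s < length (x # p) \<and> c < (x # p) ! s} = {}"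
    using assms(2) nth_le_largest[OF assms(1)]
    by (auto simp: gr0_conv_Suc) (meson leD le_trans)
  then show ?thesis
    using assms(3) hook_length_eq[of 0 "x # p" c] by (simp only: card.empty) simp
qed

text \<open>Cutting the first row at column \<open>largest p\<close> separates the cells lying above
  the second row from those beyond it. These two groups yield the two sets of the recursion.\<close>

lemma row_hooks_eq_hook_lengths:
  "is_partition p \<Longrightarrow> row_hooks p = (\<lambda>c. hook_length p (0, c)) ` {..<largest p}"
proof (induction p)
  case (Cons x p)
  let ?y = "largest p"
  have part: "is_partition p" and le: "?y \<le> x"
    using Cons.prems by (auto simp: is_partition_Cons)
  have "{..<x} = {..<?y} \<union> {?y..<x}"
    using le by auto
  then have "(\<lambda>c. hook_length (x # p) (0, c)) ` {..<x} =
      (\<lambda>c. hook_length (x # p) (0, c)) ` {..<?y} \<union> (\<lambda>c. hook_length (x # p) (0, c)) ` {?y..<x}"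
    by (metis image_Un)
  also have "(\<lambda>c. hook_length (x # p) (0, c)) ` {?y..<x} = (\<lambda>c. x - c) ` {?y..<x}"
    using part by (intro image_cong) (auto simp: hook_length_Cons_0_beyond)
  also have "\<dots> = {1..x - ?y}"
  proof (intro equalityI subsetI)
    fix g assume "g \<in> {1..x - ?y}"
    then show "g \<in> (\<lambda>c. x - c) ` {?y..<x}"
      by (intro image_eqI[of _ _ "x - g"]) auto
  qed auto
  also have "(\<lambda>c. hook_length (x # p) (0, c)) ` {..<?y} =
      (\<lambda>c. Suc (x - ?y) + hook_length p (0, c)) ` {..<?y}"
    using le by (intro image_cong) (auto simp: hook_length_Cons_0)
  also have "\<dots> = (+) (Suc (x - ?y)) ` row_hooks p"
    using Cons.IH[OF part] by (simp add: image_image)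
  finally show ?case
    by (simp add: Un_commute)
qed simp

section \<open>Cores in terms of first-row hooks\<close>

text \<open>The non-element 0 accounts for divisibility of the first-row hooks. Every other
  non-element is at least the shift, so it and all larger elements lie in the translated copy, and
  translation preserves differences.\<close>

lemma core_set_row_hooks_Cons:
  "core_set a (row_hooks (x # p)) \<longleftrightarrow>
    (\<forall>g\<in>row_hooks (x # p). \<not> a dvd g) \<and> core_set a (row_hooks p)" (is "?L \<longleftrightarrow> ?N \<and> ?R")
proof
  let ?s = "Suc (x - largest p)"
  let ?G = "row_hooks (x # p)"
  note shift = shift_mem_row_hooks_Cons[of x p]
  show "?N \<and> ?R" if L: ?L
  proof
    show ?N
    proof
      fix g assume "g \<in> ?G"
      moreover from this have "0 < g"
        using zero_notin_row_hooks[of "x # p"] by (metis gr0I)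
      ultimately show "\<not> a dvd g"
        using L zero_notin_row_hooks[of "x # p"] unfolding core_set_def by (metis diff_zero)
    qed
    have "\<not> a dvd g - b" if "g \<in> row_hooks p" "b \<notin> row_hooks p" "b < g" for g b
    proof -
      have "?s + g \<in> ?G" "?s + b \<notin> ?G" "?s + b < ?s + g"
        using that shift by auto
      then have "\<not> a dvd (?s + g) - (?s + b)"
        using L unfolding core_set_def by blast
      then show ?thesis by simp
    qed
    then show ?R
      by (simp add: core_set_def)
  qed
  show ?L if R: "?N \<and> ?R"
  proof -
    have "\<not> a dvd g - b" if g: "g \<in> ?G" and b: "b \<notin> ?G" and less: "b < g" for g b
    proof (cases "b = 0")
      case True
      then show ?thesis using R g by simp
    next
      case False
      then have "?s \<le> b"
        using b by auto
      then obtain b' g' where eq: "b = ?s + b'" "g = ?s + g'"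
        using less by (metis le_iff_add less_imp_le_nat order_trans)
      then have "g' \<in> row_hooks p" "b' \<notin> row_hooks p" "b' < g'"
        using g b less shift by (blast, blast, simp)
      then have "\<not> a dvd g' - b'"
        using R unfolding core_set_def by blast
      then show ?thesis
        by (simp add: eq)
    qed
    then show ?thesis
      by (simp add: core_set_def del: row_hooks.simps)
  qed
qed

lemma ferrers_Cons: "ferrers (x # p) = Pair 0 ` {..<x} \<union> (\<lambda>(r, c). (Suc r, c)) ` ferrers p"
  by (auto simp: ferrers_def image_iff less_Suc_eq_0_disj)

text \<open>Removing the top row discards the non-element 0 and moves the next one to 0. So the
  hooks of each row are the positive differences between elements and one fixed non-element, and the
  first row controls the whole diagram.\<close>

lemma is_core_iff: "is_core a p \<longleftrightarrow> is_partition p \<and> core_set a (row_hooks p)"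
proof (induction p)
  case Nil
  show ?case
    by (simp add: is_core_def core_set_def ferrers_def)
next
  case (Cons x p)
  have "(\<forall>u\<in>ferrers (x # p). \<not> a dvd hook_length (x # p) u) \<longleftrightarrow>
     (\<forall>c<x. \<not> a dvd hook_length (x # p) (0, c)) \<and> (\<forall>u\<in>ferrers p. \<not> a dvd hook_length p u)"
    unfolding ferrers_Cons ball_Un ball_simps
    by (intro arg_cong2[of _ _ _ _ "(\<and>)"]) (auto simp: ferrers_def hook_length_Cons_Suc)
  moreover have "(\<forall>c<x. \<not> a dvd hook_length (x # p) (0, c)) \<longleftrightarrow>
      (\<forall>g\<in>row_hooks (x # p). \<not> a dvd g)" if "is_partition (x # p)"
    unfolding row_hooks_eq_hook_lengths[OF that] by auto
  ultimately show ?case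
    using Cons.IH by (auto simp: is_core_def core_set_row_hooks_Cons is_partition_Cons
        simp del: row_hooks.simps)
qed

section \<open>Partitions as finite sets of positive integers\<close>

text \<open>The first part is the cardinality, and the shift is the least positive non-element. Both
  depend on the set alone, so undoing the shift recovers the hooks of the remaining rows.\<close>

lemma row_hooks_Cons_cong:
  assumes "row_hooks (x # p) = row_hooks (z # q)" "is_partition (x # p)" "is_partition (z # q)"
  shows "x = z" "row_hooks p = row_hooks q"
proof -
  let ?s = "Suc (x - largest p)" and ?t = "Suc (z - largest q)"
  show "x = z"
    using assms by (metis card_row_hooks largest_simps(2))
  have "?s \<notin> row_hooks (x # p)" "?t \<notin> row_hooks (z # q)"
    by auto
  moreover have "k \<in> row_hooks (x # p)" if "0 < k" "k < ?s" for k
    using that by auto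
  moreover have "k \<in> row_hooks (z # q)" if "0 < k" "k < ?t" for k
    using that by auto
  ultimately have "?s = ?t"
    using assms(1) by (metis linorder_neqE_nat zero_less_Suc)
  then show "row_hooks p = row_hooks q"
    using shift_mem_row_hooks_Cons[of x p] shift_mem_row_hooks_Cons[of z q] assms(1)
    by (metis subset_antisym subsetI)
qed

lemma inj_on_row_hooks: "inj_on row_hooks {p. is_partition p}"
proof -
  have "p = q" if "is_partition p" "is_partition q" "row_hooks p = row_hooks q" for p q
    using that
  proof (induction p arbitrary: q)
    case Nil
    then have "largest q = 0"
      using card_row_hooks[of q] by simp
    then show ?case
      using Nil largest_pos[of q] by auto
  next
    case (Cons x p)
    then have "largest q = x"
      using card_row_hooks[of q] card_row_hooks[of "x # p"] by simp
    moreover have "x > 0"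
      using Cons.prems by (simp add: is_partition_Cons)
    ultimately obtain q' where q: "q = x # q'"
      by (cases q) auto
    then have "row_hooks p = row_hooks q'"
      using row_hooks_Cons_cong Cons.prems by blast
    then show ?case
      using Cons q by (simp add: is_partition_Cons)
  qed
  then show ?thesis
    by (auto simp: inj_on_def)
qed

text \<open>The recursion is run backwards: the set is cut at its least positive non-element, and
  the translated remainder has a smaller bound.\<close>

lemma row_hooks_surj:
  assumes "G \<subseteq> {..<n}" "0 \<notin> G"
  shows "\<exists>p. is_partition p \<and> row_hooks p = G"
  using assms
proof (induction n arbitrary: G)
  case 0
  then show ?case
    by (intro exI[of _ "[]"]) auto
next
  case (Suc n)
  show ?case
  proof (cases "G = {}")
    case True
    then show ?thesis
      by (intro exI[of _ "[]"]) auto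
  next
    case False
    \<comment> \<open>\<open>Suc m\<close> is the least positive non-element, hence \<open>m\<close>
      must be the excess of the first part over the second.\<close>
    define m where "m = (LEAST k. Suc k \<notin> G)"
    have "\<exists>k. Suc k \<notin> G"
      using Suc.prems by (intro exI[of _ "Suc n"]) auto
    then have m: "Suc m \<notin> G"
      unfolding m_def by (rule LeastI_ex)
    have below: "Suc k \<in> G" if "k < m" for k
      using not_less_Least that unfolding m_def by blast
    let ?H = "{g. Suc m + g \<in> G}"
    have "?H \<subseteq> {..<n}" "0 \<notin> ?H"
      using Suc.prems m by auto
    then obtain p where p: "is_partition p" "row_hooks p = ?H"
      using Suc.IH by blast
    have G: "G = {1..m} \<union> (+) (Suc m) ` ?H"
    proof (intro equalityI subsetI)
      fix g assume g: "g \<in> G"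
      show "g \<in> {1..m} \<union> (+) (Suc m) ` ?H"
      proof (cases "g \<le> m")
        case True
        then show ?thesis
          using g Suc.prems(2) by (cases g) auto
      next
        case False
        then have "g = Suc m + (g - Suc m)"
          by simp
        then show ?thesis
          using g by (metis (mono_tags, lifting) UnI2 imageI mem_Collect_eq)
      qed
    next
      fix g assume "g \<in> {1..m} \<union> (+) (Suc m) ` ?H"
      then show "g \<in> G"
        using below by (cases g) auto
    qed
    let ?x = "m + largest p"
    have "row_hooks (?x # p) = G"
      using p G by simp
    \<comment> \<open>A zero here would force \<open>m = 0\<close> and \<open>p = []\<close>, making
      \<open>G\<close> empty.\<close>
    moreover from this have "?x > 0"
      using False p(1) by (cases p) (auto simp: is_partition_Cons)
    ultimately show ?thesis
      using p(1) by (intro exI[of _ "?x # p"]) (simp add: is_partition_Cons)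
  qed
qed

lemma cores_largest_alt:
  "x \<ge> 1 \<Longrightarrow> cores_largest a x = {p. is_core a p \<and> largest p = x}"
  by (auto simp: cores_largest_def largest_def hd_conv_nth Suc_le_eq)

lemma bij_betw_row_hooks:
  assumes "x \<ge> 1"
  shows "bij_betw row_hooks (cores_largest a x) {G. core_set a G \<and> card G = x}"
  unfolding bij_betw_def
proof
  show "inj_on row_hooks (cores_largest a x)"
    by (rule inj_on_subset[OF inj_on_row_hooks]) (auto simp: cores_largest_def is_core_iff)
  show "row_hooks ` cores_largest a x = {G. core_set a G \<and> card G = x}"
  proof (intro equalityI subsetI)
    fix G assume G: "G \<in> {G. core_set a G \<and> card G = x}"
    then have "finite G" "0 \<notin> G"
      by (auto simp: core_set_def)
    then obtain p where "is_partition p" "row_hooks p = G"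
      using row_hooks_surj finite_nat_set_iff_bounded by (metis lessThan_iff subsetI)
    then show "G \<in> row_hooks ` cores_largest a x"
      using G assms card_row_hooks[of p]
      by (intro image_eqI[of _ _ p]) (auto simp: cores_largest_alt is_core_iff)
  qed (auto simp: cores_largest_alt[OF assms] is_core_iff card_row_hooks)
qed

section \<open>Multiplicity of the largest part and the second part\<close>

text \<open>If the two top parts agree, the shift is 1, so the least element and the multiplicity
  both grow by one when the top row is added. If they differ, the multiplicity is 1 and so is the
  least element.\<close>

lemma count_largest_eq_iff:
  assumes "is_partition p" "p \<noteq> []"
  shows "count_list p (largest p) = i \<longleftrightarrow>
    i \<in> row_hooks p \<and> (\<forall>k<i. k \<notin> row_hooks p)"
  using assms
proof (induction p arbitrary: i)
  case (Cons x p)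
  have part: "is_partition p" "largest p \<le> x" "x > 0"
    using Cons.prems by (auto simp: is_partition_Cons)
  show ?case
  proof (cases "largest p = x")
    case True
    then have "p \<noteq> []"
      using part by auto
    then have IH: "count_list p x = i \<longleftrightarrow> i \<in> row_hooks p \<and> (\<forall>k<i. k \<notin> row_hooks p)" for i
      using Cons.IH part True by blast
    show ?thesis
    proof (cases i)
      case 0
      then show ?thesis
        using zero_notin_row_hooks[of "x # p"] by simp
    next
      case (Suc j)
      have "row_hooks (x # p) = Suc ` row_hooks p"
        using True by simp
      then show ?thesis
        unfolding Suc All_less_Suc2 using IH[of j] by (auto simp: image_iff)
    qed
  next
    case False
    then have "x \<notin> set p"
      using part nth_le_largest[of p] by (metis in_set_conv_nth order_antisym)
    then have "count_list (x # p) (largest (x # p)) = 1"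
      by simp
    moreover have "1 \<in> row_hooks (x # p)"
      using False part by auto
    ultimately show ?thesis
      using zero_notin_row_hooks[of "x # p"] by (metis less_one linorder_neqE_nat)
  qed
qed simp

lemma second_part_eq_iff:
  assumes "is_partition p" "largest p = x" "1 \<le> y" "y \<le> x"
  shows "length p \<ge> 2 \<and> p ! 1 = y \<longleftrightarrow>
    {1..x - y} \<subseteq> row_hooks p \<and> Suc (x - y) \<notin> row_hooks p"
proof (cases p)
  case Nil
  then show ?thesis
    using assms by simp
next
  case (Cons z q)
  then have z: "z = x" and le: "largest q \<le> x"
    using assms by (auto simp: is_partition_Cons)
  \<comment> \<open>Positivity of \<open>y\<close> distinguishes a real second part from the value 0
    of \<open>largest\<close> on an empty tail.\<close>
  have "length p \<ge> 2 \<and> p ! 1 = y \<longleftrightarrow> largest q = y"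
    using Cons assms(3) by (cases q) auto
  also have "\<dots> \<longleftrightarrow> {1..x - y} \<subseteq> row_hooks p \<and> Suc (x - y) \<notin> row_hooks p"
  proof
    assume R: "{1..x - y} \<subseteq> row_hooks p \<and> Suc (x - y) \<notin> row_hooks p"
    have "\<not> x - largest q < x - y"
    proof
      assume "x - largest q < x - y"
      then have "Suc (x - largest q) \<in> row_hooks p"
        using R by auto
      then show False
        using Cons z by auto
    qed
    moreover have "\<not> x - y < x - largest q"
      using R Cons z by auto
    ultimately show "largest q = y"
      using le assms(4) by linarith
  qed (use Cons z in auto)
  finally show ?thesis .
qed

section \<open>Runners of the abacus\<close>

text \<open>Entry \<open>j\<close> of the list (0-based) is the number of elements congruent to \<open>j + 1\<close> modulo \<open>a\<close>.\<close>

definition runner_set :: "nat \<Rightarrow> nat list \<Rightarrow> nat set" where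
  "runner_set a l = {g. g mod a \<noteq> 0 \<and> g div a < l ! (g mod a - 1)}"

lemma mem_runner_set:
  assumes "Suc j < a"
  shows "k * a + Suc j \<in> runner_set a l \<longleftrightarrow> k < l ! j"
proof -
  have "(k * a + Suc j) mod a = Suc j" "(k * a + Suc j) div a = k"
    using assms by (simp_all del: add_Suc_right)
  then show ?thesis
    by (simp add: runner_set_def)
qed

text \<open>The bottom positions of the runners are the numbers below \<open>a\<close>. They show
  which entries are nonzero, which is all that the conditions on multiplicity and second part
  inspect.\<close>

lemma Suc_mem_runner_set: "Suc j < a \<Longrightarrow> Suc j \<in> runner_set a l \<longleftrightarrow> 0 < l ! j"
  using mem_runner_set[of j a 0 l] by simp

lemma zero_notin_runner_set [simp]: "0 \<notin> runner_set a l"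
  by (simp add: runner_set_def)

lemma residue_decomp:
  fixes g :: nat
  assumes "g mod a \<noteq> 0" "a > 0"
  obtains k j where "Suc j < a" "g = k * a + Suc j"
proof
  show "Suc (g mod a - 1) < a"
    using assms by simp
  show "g = (g div a) * a + Suc (g mod a - 1)"
    using assms by simp
qed

lemma runner_set_eq_UN:
  assumes "a > 0"
  shows "runner_set a l = (\<Union>j<a - 1. (\<lambda>k. k * a + Suc j) ` {..<l ! j})"
proof (intro equalityI subsetI)
  fix g assume g: "g \<in> runner_set a l"
  then have "g mod a \<noteq> 0"
    by (simp add: runner_set_def)
  then obtain k j where "Suc j < a" "g = k * a + Suc j"
    using assms by (rule residue_decomp)
  then show "g \<in> (\<Union>j<a - 1. (\<lambda>k. k * a + Suc j) ` {..<l ! j})"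
    using g by (auto simp: mem_runner_set simp del: add_Suc_right)
qed (auto simp: mem_runner_set simp del: add_Suc_right)

lemma card_runner_set:
  assumes "a > 0" "length l = a - 1"
  shows "card (runner_set a l) = sum_list l"
proof -
  have "card (runner_set a l) = (\<Sum>j<a - 1. card ((\<lambda>k. k * a + Suc j) ` {..<l ! j}))"
    unfolding runner_set_eq_UN[OF assms(1)]
  proof (rule card_UN_disjoint)
    show "\<forall>i\<in>{..<a - 1}. \<forall>j\<in>{..<a - 1}. i \<noteq> j \<longrightarrow>
      (\<lambda>k. k * a + Suc i) ` {..<l ! i} \<inter> (\<lambda>k. k * a + Suc j) ` {..<l ! j} = {}"
    proof (intro ballI impI)
      fix i j assume ij: "i \<in> {..<a - 1}" "j \<in> {..<a - 1}" "i \<noteq> j"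
      have "k * a + Suc i \<noteq> m * a + Suc j" for k m
      proof
        assume "k * a + Suc i = m * a + Suc j"
        then have "(k * a + Suc i) mod a = (m * a + Suc j) mod a"
          by simp
        then show False
          using ij by simp
      qed
      then show "(\<lambda>k. k * a + Suc i) ` {..<l ! i} \<inter> (\<lambda>k. k * a + Suc j) ` {..<l ! j} = {}"
        by blast
    qed
  qed auto
  also have "\<dots> = (\<Sum>j<a - 1. l ! j)"
    using assms(1) by (intro sum.cong) (auto simp: card_image inj_on_def)
  finally show ?thesis
    using assms(2) by (simp add: sum_list_sum_nth atLeast0LessThan)
qed

text \<open>Numbers differing by a multiple of \<open>a\<close> share a runner, and each runner is
  filled from the bottom.\<close>

lemma core_set_runner_set:
  assumes "a > 0"
  shows "core_set a (runner_set a l)"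
  unfolding core_set_def
proof (intro conjI ballI allI impI notI)
  show "finite (runner_set a l)"
    using assms by (simp add: runner_set_eq_UN)
  fix g b assume g: "g \<in> runner_set a l" and b: "b \<notin> runner_set a l \<and> b < g" and "a dvd g - b"
  then have "g mod a = b mod a"
    by (simp add: mod_eq_dvd_iff_nat)
  moreover have "b div a \<le> g div a"
    using b by (simp add: div_le_mono)
  ultimately show False
    using g b by (simp add: runner_set_def)
qed simp

text \<open>The set is compared with \<open>{..k}\<close> or \<open>{..<k}\<close>. This turns the
  content of a runner into a single list entry.\<close>

lemma mem_initial_segment_iff:
  fixes K :: "nat set"
  assumes "finite K" "\<And>k j. k \<in> K \<Longrightarrow> j < k \<Longrightarrow> j \<in> K"
  shows "k < card K \<longleftrightarrow> k \<in> K"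
proof
  assume "k \<in> K"
  then have "{..k} \<subseteq> K"
    using assms(2) by (auto simp: le_less)
  then show "k < card K"
    using card_mono[OF assms(1), of "{..k}"] by simp
next
  assume "k < card K"
  show "k \<in> K"
  proof (rule ccontr)
    assume "k \<notin> K"
    then have "K \<subseteq> {..<k}"
      using assms(2) by (metis lessThan_iff linorder_neqE_nat subsetI)
    then show False
      using \<open>k < card K\<close> card_mono[of "{..<k}" K] by simp
  qed
qed

lemma core_set_imp_runner_set:
  assumes "core_set a G" "a > 0"
  shows "\<exists>l. length l = a - 1 \<and> runner_set a l = G"
proof (intro exI conjI)
  let ?K = "\<lambda>j. {k. k * a + Suc j \<in> G}"
  \<comment> \<open>Each entry counts the elements on its runner. The core condition makes the
    occupied heights downward closed, so the count determines them.\<close>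
  let ?l = "map (\<lambda>j. card (?K j)) [0..<a - 1]"
  show "length ?l = a - 1"
    by simp
  have G: "finite G" "0 \<notin> G" "\<And>g b. g \<in> G \<Longrightarrow> b < g \<Longrightarrow> a dvd g - b \<Longrightarrow> b \<in> G"
    using assms(1) by (auto simp: core_set_def)
  have K: "k < card (?K j) \<longleftrightarrow> k \<in> ?K j" for k j
  proof (rule mem_initial_segment_iff)
    have "inj (\<lambda>k. k * a + Suc j)"
      using assms(2) by (auto simp: inj_on_def)
    then show "finite (?K j)"
      using finite_vimageI[OF G(1)] by (simp add: vimage_def)
    fix k i assume "k \<in> ?K j" "i < k"
    moreover have "k * a + Suc j - (i * a + Suc j) = (k - i) * a"
      by (simp add: diff_mult_distrib)
    ultimately show "i \<in> ?K j"
      using assms(2) G(3)[of "k * a + Suc j" "i * a + Suc j"] by simp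
  qed
  show "runner_set a ?l = G"
  proof (rule set_eqI)
    fix g
    show "g \<in> runner_set a ?l \<longleftrightarrow> g \<in> G"
    proof (cases "g mod a = 0")
      case True
      then have "a dvd g"
        by (simp add: dvd_eq_mod_eq_0)
      \<comment> \<open>The runner of residue 0 is empty, since any element on it would force 0 into
        \<open>G\<close>.\<close>
      then have "g \<notin> G"
        using G(2) G(3)[of g 0] by (cases "g = 0") auto
      then show ?thesis
        using True by (simp add: runner_set_def)
    next
      case False
      then obtain k j where g: "Suc j < a" "g = k * a + Suc j"
        using assms(2) by (rule residue_decomp)
      then have "g \<in> runner_set a ?l \<longleftrightarrow> k < card (?K j)"
        using mem_runner_set[of j a k ?l] by simp
      then show ?thesis
        using K[of k j] g(2) by simp
    qed
  qed
qed

lemma bij_betw_runner_set: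
  assumes "a > 0"
  shows "bij_betw (runner_set a) {l. length l = a - 1 \<and> sum_list l = x}
    {G. core_set a G \<and> card G = x}"
  unfolding bij_betw_def
proof
  show "inj_on (runner_set a) {l. length l = a - 1 \<and> sum_list l = x}"
  proof (rule inj_onI, clarify)
    fix l m :: "nat list"
    assume len: "length l = a - 1" "length m = a - 1" and eq: "runner_set a l = runner_set a m"
    show "l = m"
    proof (rule nth_equalityI)
      fix j assume "j < length l"
      then have "Suc j < a"
        using len by simp
      then have "k < l ! j \<longleftrightarrow> k < m ! j" for k
        using mem_runner_set[of j a k] eq by blast
      then show "l ! j = m ! j"
        by (metis linorder_neqE_nat nat_less_le)
    qed (use len in simp)
  qed
  show "runner_set a ` {l. length l = a - 1 \<and> sum_list l = x} = {G. core_set a G \<and> card G = x}"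
  proof (intro equalityI subsetI)
    fix G assume G: "G \<in> {G. core_set a G \<and> card G = x}"
    then obtain l where "length l = a - 1" "runner_set a l = G"
      using core_set_imp_runner_set[OF _ assms] by blast
    then show "G \<in> runner_set a ` {l. length l = a - 1 \<and> sum_list l = x}"
      using G card_runner_set[OF assms, of l] by (intro image_eqI[of _ _ l]) auto
  qed (auto simp: core_set_runner_set[OF assms] card_runner_set[OF assms])
qed

section \<open>From partitions to weak compositions\<close>

lemma finite_length_sum_list: "finite {l :: nat list. length l = m \<and> sum_list l = n}"
proof (rule finite_subset)
  show "{l. length l = m \<and> sum_list l = n} \<subseteq> {l. set l \<subseteq> {..n} \<and> length l = m}"
    by (auto simp: member_le_sum_list)
qed (simp add: finite_lists_length_eq)

text \<open>Both bijections are restricted at once to a property visible on the hook set. Finiteness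
  is pulled back from the compositions, and every claim of the theorem is an instance.\<close>

lemma finite_card_cores:
  fixes a x :: nat
  assumes "a > 0" "x \<ge> 1"
    and "\<And>p. p \<in> cores_largest a x \<Longrightarrow> Q p \<longleftrightarrow> P (row_hooks p)"
  shows "finite {p \<in> cores_largest a x. Q p} \<and> card {p \<in> cores_largest a x. Q p} =
    card {l. length l = a - 1 \<and> sum_list l = x \<and> P (runner_set a l)}"
proof -
  let ?A = "{p \<in> cores_largest a x. Q p}" and ?B = "{G. core_set a G \<and> card G = x \<and> P G}"
    and ?C = "{l. length l = a - 1 \<and> sum_list l = x \<and> P (runner_set a l)}"
  have AB: "bij_betw row_hooks ?A ?B"
  proof (rule bij_betw_subset[OF bij_betw_row_hooks[OF assms(2)]])
    have "row_hooks ` ?A = {G \<in> row_hooks ` cores_largest a x. P G}"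
      using assms(3) by blast
    then show "row_hooks ` ?A = ?B"
      unfolding bij_betw_imp_surj_on[OF bij_betw_row_hooks[OF assms(2)]] by blast
  qed auto
  have CB: "bij_betw (runner_set a) ?C ?B"
  proof (rule bij_betw_subset[OF bij_betw_runner_set[OF assms(1), of x]])
    have "runner_set a ` ?C =
        {G \<in> runner_set a ` {l. length l = a - 1 \<and> sum_list l = x}. P G}"
      by blast
    then show "runner_set a ` ?C = ?B"
      unfolding bij_betw_imp_surj_on[OF bij_betw_runner_set[OF assms(1)]] by blast
  qed auto
  have "finite ?C"
    by (rule finite_subset[OF _ finite_length_sum_list[of "a - 1" x]]) auto
  then show ?thesis
    using bij_betw_finite[OF AB] bij_betw_finite[OF CB]
      bij_betw_same_card[OF AB] bij_betw_same_card[OF CB] by simp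
qed

section \<open>Counting weak compositions\<close>

lemma sum_list_map_Suc: "sum_list (map Suc l) = length l + sum_list l"
  by (induction l) auto

text \<open>Dropping the \<open>j\<close> leading zeros and lowering the next entry by one leaves an
  arbitrary weak composition of \<open>x - 1\<close> into \<open>m - j\<close> entries. Stars and
  bars counts these.\<close>

lemma card_first_nonzero:
  assumes "j < m" "x \<ge> 1"
  shows "card {l :: nat list. length l = m \<and> sum_list l = x \<and> 0 < l ! j \<and> (\<forall>k<j. l ! k = 0)} =
    (x + m - j - 2) choose (m - j - 1)"
proof -
  let ?f = "\<lambda>l. replicate j 0 @ Suc (hd l) # tl l"
  let ?L = "{l :: nat list. length l = m - j \<and> sum_list l = x - 1}"
  let ?R = "{l :: nat list. length l = m \<and> sum_list l = x \<and> 0 < l ! j \<and> (\<forall>k<j. l ! k = 0)}"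
  have nonempty: "l \<noteq> []" if "l \<in> ?L" for l
    using that assms(1) by auto
  have inj: "inj_on ?f ?L"
    by (rule inj_onI) (use nonempty list.expand in auto)
  have img: "?f ` ?L = ?R"
  proof (intro equalityI subsetI)
    fix l assume "l \<in> ?f ` ?L"
    then obtain l' where l': "l' \<in> ?L" "l = ?f l'"
      by blast
    then show "l \<in> ?R"
      using assms nonempty[of l'] by (cases l') (auto simp: nth_append)
  next
    fix l assume l: "l \<in> ?R"
    then have "take j l = replicate j 0"
      using assms(1) by (intro nth_equalityI) auto
    then have eq: "l = replicate j 0 @ l ! j # drop (Suc j) l"
      using l assms(1) id_take_nth_drop[of j l] by simp
    have "sum_list l = l ! j + sum_list (drop (Suc j) l)"
      using arg_cong[OF eq, of sum_list] by (simp add: sum_list_replicate)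
    then have "(l ! j - 1) # drop (Suc j) l \<in> ?L"
      using l assms by auto
    moreover have "l = ?f ((l ! j - 1) # drop (Suc j) l)"
      using l by (simp add: eq[symmetric])
    ultimately show "l \<in> ?f ` ?L"
      by blast
  qed
  have "card ?R = card ?L"
    unfolding img[symmetric] by (rule card_image[OF inj])
  also have "\<dots> = (x + m - j - 2) choose (x - 1)"
    using assms unfolding card_length_sum_list by (intro arg_cong2[of _ _ _ _ binomial]) auto
  also have "\<dots> = (x + m - j - 2) choose (m - j - 1)"
    using assms by (subst binomial_symmetric) (auto intro!: arg_cong2[of _ _ _ _ binomial])
  finally show ?thesis .
qed

text \<open>Deleting the zero at position \<open>d\<close> and lowering the \<open>d\<close> entries
  before it leaves an arbitrary weak composition of \<open>y\<close> into \<open>m - 1\<close>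
  entries.\<close>

lemma card_first_zero:
  assumes "d < m"
  shows "card {l :: nat list. length l = m \<and> sum_list l = d + y \<and> (\<forall>k<d. 0 < l ! k) \<and> l ! d = 0} =
    (y + m - 2) choose y"
proof -
  let ?f = "\<lambda>l. map Suc (take d l) @ 0 # drop d l"
  let ?L = "{l :: nat list. length l = m - 1 \<and> sum_list l = y}"
  let ?R = "{l :: nat list. length l = m \<and> sum_list l = d + y \<and> (\<forall>k<d. 0 < l ! k) \<and> l ! d = 0}"
  have inj: "inj_on ?f ?L"
  proof (rule inj_onI)
    fix l l' assume "l \<in> ?L" "l' \<in> ?L" "?f l = ?f l'"
    then have "take d l = take d l'" "drop d l = drop d l'"
      by (auto simp: inj_map_eq_map)
    then show "l = l'"
      by (metis append_take_drop_id)
  qed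
  have img: "?f ` ?L = ?R"
  proof (intro equalityI subsetI)
    fix l assume "l \<in> ?f ` ?L"
    then obtain l' where l': "length l' = m - 1" "sum_list l' = y" "l = ?f l'"
      by blast
    have "sum_list (take d l') + sum_list (drop d l') = y"
      using l'(2) by (metis append_take_drop_id sum_list_append)
    then show "l \<in> ?R"
      using assms l' by (auto simp: nth_append sum_list_map_Suc)
  next
    fix l assume l: "l \<in> ?R"
    let ?t = "map (\<lambda>n. n - 1) (take d l)"
    have t: "map Suc ?t = take d l"
      using l assms by (intro nth_equalityI) auto
    have len: "length ?t = d"
      using l assms by simp
    have eq: "l = map Suc ?t @ 0 # drop (Suc d) l"
      unfolding t using l assms id_take_nth_drop[of d l] by simp
    have "sum_list l = d + sum_list ?t + sum_list (drop (Suc d) l)"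
      using l assms arg_cong[OF eq, of sum_list]
      by (simp only: sum_list_append sum_list.Cons sum_list_map_Suc) simp
    then have "?t @ drop (Suc d) l \<in> ?L"
      using l assms by auto
    \<comment> \<open>\<open>?t\<close> has length exactly \<open>d\<close>, so \<open>?f\<close>
      splits the shortened list where the zero was removed.\<close>
    moreover have "l = ?f (?t @ drop (Suc d) l)"
      using eq len by (simp only: take_append drop_append take_all drop_all append_Nil append_Nil2
          diff_self_eq_0 take0 drop0 order_refl)
    ultimately show "l \<in> ?f ` ?L"
      by blast
  qed
  have "card ?R = card ?L"
    unfolding img[symmetric] by (rule card_image[OF inj])
  also have "\<dots> = (y + m - 2) choose y"
    using assms unfolding card_length_sum_list by (intro arg_cong2[of _ _ _ _ binomial]) auto
  finally show ?thesis .
qed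

text \<open>Lowering every entry by one leaves an arbitrary weak composition of
  \<open>y\<close>.\<close>

lemma card_all_nonzero:
  "card {l :: nat list. length l = m \<and> sum_list l = m + y \<and> (\<forall>k<m. 0 < l ! k)} =
    (y + m - 1) choose y"
proof -
  let ?L = "{l :: nat list. length l = m \<and> sum_list l = y}"
  let ?R = "{l :: nat list. length l = m \<and> sum_list l = m + y \<and> (\<forall>k<m. 0 < l ! k)}"
  have img: "map Suc ` ?L = ?R"
  proof (intro equalityI subsetI)
    fix l assume l: "l \<in> ?R"
    let ?t = "map (\<lambda>n. n - 1) l"
    have t: "l = map Suc ?t"
      using l by (intro nth_equalityI) auto
    have "sum_list l = m + sum_list ?t"
      using l arg_cong[OF t, of sum_list] by (simp only: sum_list_map_Suc) simp
    then have "?t \<in> ?L"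
      using l by simp
    then show "l \<in> map Suc ` ?L"
      using t by blast
  qed (auto simp: sum_list_map_Suc)
  have inj: "inj_on (map Suc) ?L"
    by (simp add: inj_on_def inj_map_eq_map)
  have "card ?R = card ?L"
    unfolding img[symmetric] by (rule card_image[OF inj])
  then show ?thesis
    by (simp add: card_length_sum_list)
qed

section \<open>Binomial values of the three counts\<close>

theorem theorem4p4:
  fixes a x :: nat
  assumes "a \<ge> 2" and "x \<ge> 1"
  shows
    "(\<forall>i\<ge>1. finite (cores_largest_mult a x i) \<and>
        card (cores_largest_mult a x i) = binom (int x + int a - 2 - int i) (int a - 1 - int i)) \<and>
     (finite (cores_largest a x) \<and>
        card (cores_largest a x) = binom (int x + int a - 2) (int x)) \<and>
     (\<forall>y. 1 \<le> y \<and> y \<le> x \<longrightarrow>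
        (int x - int y < int a - 1 \<longrightarrow> finite (cores_two_largest a x y) \<and>
           card (cores_two_largest a x y) = binom (int y + int a - 3) (int y)) \<and>
        (int x - int y = int a - 1 \<longrightarrow> finite (cores_two_largest a x y) \<and>
           card (cores_two_largest a x y) = binom (int y + int a - 2) (int y)))"
proof (intro conjI allI impI)
  have a: "a > 0"
    using assms(1) by simp
  have core: "is_partition p" "p \<noteq> []" "largest p = x" if "p \<in> cores_largest a x" for p
    using that assms(2) by (auto simp: cores_largest_alt is_core_def)
  note count = finite_card_cores[OF a assms(2)]
  have "card {l :: nat list. length l = a - 1 \<and> sum_list l = x} = binom (int x + int a - 2) (int x)"
    using assms by (simp add: card_length_sum_list binom_def nat_diff_distrib nat_add_distrib numeral_2_eq_2)
  then show "finite (cores_largest a x)"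
    "card (cores_largest a x) = binom (int x + int a - 2) (int x)"
    using count[of "\<lambda>_. True" "\<lambda>_. True"] by auto
  {
    fix i :: nat assume i: "1 \<le> i"
    let ?P = "\<lambda>G. i \<in> G \<and> (\<forall>k<i. k \<notin> G)"
    let ?R = "{l. length l = a - 1 \<and> sum_list l = x \<and> ?P (runner_set a l)}"
    have "count_list p x = i \<longleftrightarrow> ?P (row_hooks p)" if "p \<in> cores_largest a x" for p
      using count_largest_eq_iff[OF core(1,2)[OF that]] core(3)[OF that] by simp
    then have "finite (cores_largest_mult a x i) \<and> card (cores_largest_mult a x i) = card ?R"
      unfolding cores_largest_mult_def by (rule count)
    moreover have "card ?R = binom (int x + int a - 2 - int i) (int a - 1 - int i)"
    \<comment> \<open>For \<open>i < a\<close> the least element \<open>i\<close> is the bottom of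
      runner \<open>i - 1\<close>, and all earlier runners are empty.\<close>
    proof (cases "i < a")
      case True
      obtain j where j: "i = Suc j"
        using i by (cases i) auto
      have "?P (runner_set a l) \<longleftrightarrow> 0 < l ! j \<and> (\<forall>k<j. l ! k = 0)" for l
        using True by (simp add: j Suc_mem_runner_set All_less_Suc2)
      then have "card ?R = (x + (a - 1) - j - 2) choose (a - 1 - j - 1)"
        using card_first_nonzero[of j "a - 1" x] True j assms(2) by simp
      moreover have "nat (int x + int a - 2 - int i) = x + (a - 1) - j - 2"
        "nat (int a - 1 - int i) = a - 1 - j - 1"
        using True j assms(2) by linarith+
      ultimately show ?thesis
        using True assms(2) by (simp add: binom_def)
    next
      case False
      \<comment> \<open>As \<open>x \<ge> 1\<close>, some runner is nonempty, and its bottom is an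
        element below \<open>a \<le> i\<close>. The count is therefore 0, matching the convention
        for a negative lower index.\<close>
      have "\<not> ?P (runner_set a l)" if len: "length l = a - 1" and sum: "sum_list l = x" for l
      proof -
        obtain j where j: "j < length l" "0 < l ! j"
          using sum assms(2) by (metis in_set_conv_nth not_one_le_zero gr0I sum_list_eq_0_iff)
        then have "Suc j < a"
          using len by simp
        then have "Suc j \<in> runner_set a l" "Suc j < i"
          using j(2) False by (simp_all add: Suc_mem_runner_set)
        then show ?thesis
          by blast
      qed
      then have "?R = {}"
        by blast
      then have "card ?R = 0"
        by (simp only: card.empty)
      then show ?thesis
        using False by (simp only: binom_def) simp
    qed
    ultimately show "finite (cores_largest_mult a x i)"
      "card (cores_largest_mult a x i) = binom (int x + int a - 2 - int i) (int a - 1 - int i)"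
      by auto
  }
  fix y assume y: "1 \<le> y \<and> y \<le> x"
  let ?d = "x - y"
  let ?P = "\<lambda>G. {1..?d} \<subseteq> G \<and> Suc ?d \<notin> G"
  let ?R = "{l. length l = a - 1 \<and> sum_list l = x \<and> ?P (runner_set a l)}"
  have "length p \<ge> 2 \<and> p ! 1 = y \<longleftrightarrow> ?P (row_hooks p)" if "p \<in> cores_largest a x" for p
    using second_part_eq_iff core(1,3)[OF that] y by blast
  then have two: "finite (cores_two_largest a x y) \<and> card (cores_two_largest a x y) = card ?R"
    unfolding cores_two_largest_def by (rule count)
  \<comment> \<open>All of 1 to \<open>?d\<close> lie below \<open>a\<close>, so each is the bottom
    of a runner.\<close>
  have initial: "{1..?d} \<subseteq> runner_set a l \<longleftrightarrow> (\<forall>k<?d. 0 < l ! k)" if "?d < a" for l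
  proof -
    have "{1..?d} = Suc ` {..<?d}"
      by (simp add: image_Suc_lessThan)
    then show ?thesis
      using that by (auto simp: Suc_mem_runner_set image_subset_iff)
  qed
  show "finite (cores_two_largest a x y)" "finite (cores_two_largest a x y)"
    using two by auto
  show "card (cores_two_largest a x y) = binom (int y + int a - 3) (int y)"
    if "int x - int y < int a - 1"
  proof -
    \<comment> \<open>The first gap \<open>Suc ?d\<close> is still the bottom of a runner, so its
      absence means that entry \<open>?d\<close> is zero.\<close>
    have d: "Suc ?d < a"
      using that y by linarith
    then have "?P (runner_set a l) \<longleftrightarrow> (\<forall>k<?d. 0 < l ! k) \<and> l ! ?d = 0" for l
      by (simp only: initial Suc_lessD Suc_mem_runner_set) simp
    then have "card ?R = (y + (a - 1) - 2) choose y"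
      using card_first_zero[of ?d "a - 1" y] d y by simp
    moreover have "nat (int y + int a - 3) = y + (a - 1) - 2"
      using assms(1) y by linarith
    ultimately show ?thesis
      using two assms(1) y by (simp add: binom_def)
  qed
  show "card (cores_two_largest a x y) = binom (int y + int a - 2) (int y)"
    if "int x - int y = int a - 1"
  proof -
    have d: "Suc ?d = a" "?d = a - 1"
      using that y by linarith+
    \<comment> \<open>Here the gap is \<open>a\<close> itself, which is on no runner. Only the
      condition that all \<open>a - 1\<close> runners be nonempty remains.\<close>
    then have "Suc ?d \<notin> runner_set a l" for l
      by (simp add: runner_set_def)
    then have "?P (runner_set a l) \<longleftrightarrow> (\<forall>k<a - 1. 0 < l ! k)" for l
      using initial[of l] d by simp
    moreover have "x = a - 1 + y"
      using d(2) y by linarith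
    ultimately have "card ?R = (y + (a - 1) - 1) choose y"
      using card_all_nonzero[of "a - 1" y] by simp
    moreover have "nat (int y + int a - 2) = y + (a - 1) - 1"
      using assms(1) y by linarith
    ultimately show ?thesis
      using two assms(1) y by (simp add: binom_def)
  qed
qed

end
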